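(* Let $\mathcal{X}$ be a random element of $\mathcal{R}^{n_1}\otimes\mathcal{R}^{n_2}$ (a random real $n_1\times n_2$ matrix) with distribution $F=F(\mathcal{X})$, and suppose that $\theta\in\mathcal{R}^{n_1}\otimes\mathcal{R}^{n_2}$ is the point of symmetry of $F$ with respect to a given notion of symmetry. Let $\mu$ and $\sigma$ be univariate location and scale measures as in the context. Then the tensor projection depth function $\mathbf{X}\mapsto\mathit{TPD}(\mathbf{X},\mathcal{X})$ defined in the context is: 1. convex; 2. symmetric for $\mu$-symmetric $F$ (i.e. $\mathit{TPD}(\theta+\mathbf{X},\mathcal{X})=\mathit{TPD}(\theta-\mathbf{X},\mathcal{X})$ for all $\mathbf{X}$ when $F$ is $\mu$-symmetric about $\theta$); 3. affine invariant, i.e. $\mathit{TPD}(\mathbf{A}\mathbf{X}\mathbf{B},\mathbf{A}\mathcal{X}\mathbf{B})=\mathit{TPD}(\mathbf{X},\mathcal{X})$ for any two non-singular matrices $\mathbf{A}$ ($n_1\times n_1$) and $\mathbf{B}$ ($n_2\times n_2$); 4. monotonic relative to the deepest point, i.e. if $\mathbf{X}_c$ is the deepest point (a maximizer of $\mathit{TPD}(\cdot,\mathcal{X})$) and $\mathbf{X}_1=\lambda\mathbf{X}_2+(1-\lambda)\mathbf{X}_c$ with $\lambda\in[0,1]$, then $\mathit{TPD}(\mathbf{X}_1,\mathcal{X})\ge\mathit{TPD}(\mathbf{X}_2,\mathcal{X})$; 5. vanishing at infinity, that is, $\mathit{TPD}(\mathbf{X},\mathcal{X})\to 0$ as $\|\mathbf{X}\|\to\infty$;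 6. maximized at the center of $\mu$-symmetric $F$ (i.e. at $\theta$ when $F$ is $\mu$-symmetric about $\theta$).
   Context: Second-order tensors in $\mathcal{R}^{n_1}\otimes\mathcal{R}^{n_2}$ are identified with real $n_1\times n_2$ matrices, acting as bilinear forms $\mathbf{X}(\mathbf{u},\mathbf{v})=\mathbf{u}^T\mathbf{X}\mathbf{v}$ for $\mathbf{u}\in\mathbb{R}^{n_1}$, $\mathbf{v}\in\mathbb{R}^{n_2}$; $\|\mathbf{X}\|$ is the Frobenius norm. Location and scale measures: $\mu$ and $\sigma$ exist uniquely, $\mu$ is translation and scale equivariant and $\sigma$ is scale equivariant and translation invariant: writing $F_Y$ for the distribution of a real random variable $Y$, $\mu(F_{sY+c})=s\mu(F_Y)+c$ and $\sigma(F_{sY+c})=|s|\sigma(F_Y)$ for any scalars $s,c$. One writes $\mu(Y)$, $\sigma(Y)$ for $\mu(F_Y)$, $\sigma(F_Y)$. Tensor outlyingness of a fixed matrix $\mathbf{X}$ with respect to $\mathcal{X}$: $$O(\mathbf{X},\mathcal{X})=\sup_{\|\mathbf{u}\|=\|\mathbf{v}\|=1}\frac{|\mathbf{u}^T\mathbf{X}\mathbf{v}-\mu(\mathbf{u}^T\mathcal{X}\mathbf{v})|}{\sigma(\mathbf{u}^T\mathcal{X}\mathbf{v})},\qquad \mathbf{u}\in\mathbb{R}^{n_1},\ \mathbf{v}\in\mathbb{R}^{n_2},$$ with the convention (as for vector projection depth) that the value is $0$ when $\mathbf{u}^T\mathbf{X}\mathbf{v}-\mu(\mathbf{u}^T\mathcal{X}\mathbf{v})=\sigma(\mathbf{u}^T\mathcal{X}\mathbf{v})=0$.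 Tensor projection depth: $\mathit{TPD}(\mathbf{X},\mathcal{X})=\dfrac{1}{1+O(\mathbf{X},\mathcal{X})}$. $\mu$-symmetry: $F$ is $\mu$-symmetric about $\theta\in\mathcal{R}^{n_1}\otimes\mathcal{R}^{n_2}$ if $\mu(\mathbf{u}^T\mathcal{X}\mathbf{v})=\mathbf{u}^T\theta\mathbf{v}$ for any pair of unit vectors $\mathbf{u}\in\mathbb{R}^{n_1}$, $\mathbf{v}\in\mathbb{R}^{n_2}$.
   Formalization: In item 1, "convex" is read as convexity of all depth regions {X : TPD(X) ≥ α} (quasi-concavity); literal convexity of the function is false, e.g. TPD(x) = 1/(1+|x|) for a 1×1 matrix with location 0 and scale 1. *)

theory Defs
  imports "HOL-Probability.Probability"
begin

text \<open>
  A tensor in the tensor product of the Euclidean spaces of dimensions \<open>n\<^sub>1\<close> and \<open>n\<^sub>2\<close> is an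
  \<open>n\<^sub>1 \<times> n\<^sub>2\<close> matrix, of type \<open>real^'n2^'n1\<close>. The library norm of that type is the Frobenius norm.
\<close>

definition bilin :: "real^'n2^'n1 \<Rightarrow> real^'n1 \<Rightarrow> real^'n2 \<Rightarrow> real" where
  "bilin X u v = u \<bullet> (X *v v)"

text \<open>If \<open>F\<close> is the distribution of \<open>Y\<close>, this is the distribution of \<open>s * Y + c\<close>.\<close>

definition affine_law :: "real measure \<Rightarrow> real \<Rightarrow> real \<Rightarrow> real measure" where
  "affine_law F s c = distr F borel (\<lambda>y. s * y + c)"

text \<open>
  Location and scale measures are functionals on a class \<open>D\<close> of distributions on the real line, the
  distributions for which they exist (for instance those with finite second moment, for mean and
  standard deviation; all distributions, for median and MAD). Equivariance under all \<open>s\<close> and \<open>c\<close>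
  presupposes that \<open>D\<close> is closed under affine maps. Values outside \<open>D\<close> are irrelevant.
\<close>

definition distribution_class :: "real measure set \<Rightarrow> bool" where
  "distribution_class D \<longleftrightarrow>
     (\<forall>F\<in>D. real_distribution F \<and> (\<forall>s c. affine_law F s c \<in> D))"

definition location_functional :: "real measure set \<Rightarrow> (real measure \<Rightarrow> real) \<Rightarrow> bool" where
  "location_functional D \<mu> \<longleftrightarrow>
     (\<forall>F\<in>D. \<forall>s c. \<mu> (affine_law F s c) = s * \<mu> F + c)"

definition scale_functional :: "real measure set \<Rightarrow> (real measure \<Rightarrow> real) \<Rightarrow> bool" where
  "scale_functional D \<sigma> \<longleftrightarrow>
     (\<forall>F\<in>D. 0 \<le> \<sigma> F \<and> (\<forall>s c. \<sigma> (affine_law F s c) = \<bar>s\<bar> * \<sigma> F))"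

definition proj_law ::
  "'a measure \<Rightarrow> ('a \<Rightarrow> real^'n2^'n1) \<Rightarrow> real^'n1 \<Rightarrow> real^'n2 \<Rightarrow> real measure" where
  "proj_law M \<X> u v = distr M borel (\<lambda>\<omega>. bilin (\<X> \<omega>) u v)"

text \<open>
  The supremum may be infinite, so the outlyingness takes values in \<open>[0, \<infinity>]\<close>. Division in
  \<^typ>\<open>ennreal\<close> has \<open>0 / 0 = 0\<close>, which is the convention for the outlyingness, and
  \<open>x / 0 = \<infinity>\<close> for \<open>x > 0\<close>.
\<close>

definition outlyingness ::
  "(real measure \<Rightarrow> real) \<Rightarrow> (real measure \<Rightarrow> real) \<Rightarrow> 'a measure \<Rightarrow>
   real^'n2^'n1 \<Rightarrow> ('a \<Rightarrow> real^'n2^'n1) \<Rightarrow> ennreal" where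
  "outlyingness \<mu> \<sigma> M X \<X> =
     (SUP (u, v) \<in> {(u, v). norm u = 1 \<and> norm v = 1}.
        ennreal \<bar>bilin X u v - \<mu> (proj_law M \<X> u v)\<bar> / ennreal (\<sigma> (proj_law M \<X> u v)))"

text \<open>The quotient is at most \<open>1\<close>, and is \<open>0\<close> when the outlyingness is infinite.\<close>

definition TPD ::
  "(real measure \<Rightarrow> real) \<Rightarrow> (real measure \<Rightarrow> real) \<Rightarrow> 'a measure \<Rightarrow>
   real^'n2^'n1 \<Rightarrow> ('a \<Rightarrow> real^'n2^'n1) \<Rightarrow> real" where
  "TPD \<mu> \<sigma> M X \<X> = enn2real (1 / (1 + outlyingness \<mu> \<sigma> M X \<X>))"

definition mu_symmetric ::
  "(real measure \<Rightarrow> real) \<Rightarrow> 'a measure \<Rightarrow> ('a \<Rightarrow> real^'n2^'n1) \<Rightarrow> real^'n2^'n1 \<Rightarrow> bool" where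
  "mu_symmetric \<mu> M \<X> \<theta> \<longleftrightarrow>
     (\<forall>u v. norm u = 1 \<longrightarrow> norm v = 1 \<longrightarrow> \<mu> (proj_law M \<X> u v) = bilin \<theta> u v)"

text \<open>
  A depth function is called convex when its depth regions (upper level sets) are convex, that is,
  when it is quasi-concave. The other reading, convexity of the function itself, already fails for
  \<open>1 / (1 + \<bar>x\<bar>)\<close>, the projection depth on the line with location \<open>0\<close> and scale \<open>1\<close>.
\<close>

definition convex_depth :: "('b::real_vector \<Rightarrow> real) \<Rightarrow> bool" where
  "convex_depth d \<longleftrightarrow> (\<forall>\<alpha>. convex {x. \<alpha> \<le> d x})"

definition deepest_point :: "('b \<Rightarrow> real) \<Rightarrow> 'b \<Rightarrow> bool" where
  "deepest_point d x \<longleftrightarrow> (\<forall>y. d y \<le> d x)"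

end

theory Submission imports Defs begin

text \<open>
  For each pair of directions the quotient in the outlyingness is quasi-convex in the tensor, hence
  so is the supremum; this gives convex depth regions, and monotonicity along segments towards a
  deepest point is a special case. By equivariance the quotient depends only on the rays through
  \<open>u\<close> and \<open>v\<close>, so the supremum may be taken over all pairs of nonzero vectors, on which nonsingular
  \<open>A\<close> and \<open>B\<close> act by the bijections \<open>u \<mapsto> A\<^sup>T u\<close> and \<open>v \<mapsto> B v\<close>. The depth vanishes at infinity because
  finitely many pairs of directions, those of the coordinate axes, already control the norm.
\<close>

text \<open>Defined for arbitrary vectors and not only for unit ones, because
  \<open>transpose A *v u\<close> and \<open>B *v v\<close> leave the unit spheres.\<close>

definition ratio ::
  "(real measure \<Rightarrow> real) \<Rightarrow> (real measure \<Rightarrow> real) \<Rightarrow> 'a measure \<Rightarrow> real^'n2^'n1 \<Rightarrow>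
   ('a \<Rightarrow> real^'n2^'n1) \<Rightarrow> real^'n1 \<Rightarrow> real^'n2 \<Rightarrow> ennreal" where
  "ratio \<mu> \<sigma> M X \<X> u v =
     ennreal \<bar>bilin X u v - \<mu> (proj_law M \<X> u v)\<bar> / ennreal (\<sigma> (proj_law M \<X> u v))"

lemma outlyingness_ratio:
  "outlyingness \<mu> \<sigma> M X \<X> =
     (SUP (u, v) \<in> {(u, v). norm u = 1 \<and> norm v = 1}. ratio \<mu> \<sigma> M X \<X> u v)"
  by (simp add: outlyingness_def ratio_def)

lemma ratio_le_outlyingness:
  "norm u = 1 \<Longrightarrow> norm v = 1 \<Longrightarrow> ratio \<mu> \<sigma> M X \<X> u v \<le> outlyingness \<mu> \<sigma> M X \<X>"
  unfolding outlyingness_ratio by (rule SUP_upper2[of "(u, v)"]) auto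

lemma outlyingness_leI:
  assumes "\<And>u v. norm u = 1 \<Longrightarrow> norm v = 1 \<Longrightarrow> ratio \<mu> \<sigma> M X \<X> u v \<le> c"
  shows "outlyingness \<mu> \<sigma> M X \<X> \<le> c"
  unfolding outlyingness_ratio by (rule SUP_least) (auto intro: assms)

section \<open>Bilinear forms, projected laws and their behaviour under scaling and matrix
  products\<close>

lemma bilin_add: "bilin (X + Y) u v = bilin X u v + bilin Y u v"
  by (simp add: bilin_def matrix_vector_mult_add_rdistrib inner_add_right)

lemma bilin_scaleR: "bilin (c *\<^sub>R X) u v = c * bilin X u v"
  by (simp add: bilin_def scaleR_matrix_vector_assoc[symmetric])

lemma bilin_diff: "bilin (X - Y) u v = bilin X u v - bilin Y u v"
  using bilin_add[of "X - Y" Y u v] by simp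

lemma bilin_scaleR_vectors: "bilin X (a *\<^sub>R u) (b *\<^sub>R v) = a * b * bilin X u v"
  by (simp add: bilin_def matrix_vector_mult_scaleR)

lemma bilin_mult: "bilin (A ** X ** B) u v = bilin X (transpose A *v u) (B *v v)"
  by (simp add: bilin_def dot_lmul_matrix matrix_vector_mul_assoc[symmetric])

lemma bilin_axis: "bilin X (axis i 1) (axis j 1) = X $ i $ j"
  by (simp add: bilin_def inner_axis' matrix_vector_mult_basis column_def)

lemma borel_measurable_bilin:
  assumes "\<X> \<in> M \<rightarrow>\<^sub>M borel"
  shows "(\<lambda>\<omega>. bilin (\<X> \<omega>) u v) \<in> borel_measurable M"
proof -
  have "linear (\<lambda>X. bilin X u v)"
    by (rule linearI) (simp_all add: bilin_add bilin_scaleR)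
  then have "(\<lambda>X. bilin X u v) \<in> borel_measurable borel"
    by (intro borel_measurable_continuous_onI linear_continuous_on)
       (simp add: linear_conv_bounded_linear)
  then show ?thesis
    using assms by (rule measurable_compose[rotated])
qed

lemma proj_law_scaleR:
  assumes "\<X> \<in> M \<rightarrow>\<^sub>M borel"
  shows "proj_law M \<X> (a *\<^sub>R u) (b *\<^sub>R v) = affine_law (proj_law M \<X> u v) (a * b) 0"
proof -
  note borel_measurable_bilin[OF assms, measurable]
  show ?thesis
    unfolding proj_law_def affine_law_def
    by (subst distr_distr) (auto simp: bilin_scaleR_vectors comp_def)
qed

lemma proj_law_mult:
  "proj_law M (\<lambda>\<omega>. A ** \<X> \<omega> ** B) u v = proj_law M \<X> (transpose A *v u) (B *v v)"
  by (simp add: proj_law_def bilin_mult)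

lemma ratio_mult:
  "ratio \<mu> \<sigma> M (A ** X ** B) (\<lambda>\<omega>. A ** \<X> \<omega> ** B) u v =
   ratio \<mu> \<sigma> M X \<X> (transpose A *v u) (B *v v)"
  by (simp add: ratio_def proj_law_mult bilin_mult)

lemma ennreal_inverse_antimono:
  assumes "a \<le> b"
  shows "inverse b \<le> inverse (a :: ennreal)"
proof (cases "a = 0 \<or> b = \<top>")
  case False
  then obtain x y where "a = ennreal x" "b = ennreal y" "0 < x" "x \<le> y"
    using assms by (cases a; cases b) (auto simp: ennreal_le_iff2 order.strict_iff_order top_unique)
  then show ?thesis
    by (simp add: inverse_ennreal ennreal_leI le_imp_inverse_le)
qed auto

lemma norm_scaleR_sgn: "norm x *\<^sub>R sgn x = (x :: 'a :: real_normed_vector)"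
  by (cases "x = 0") (simp_all add: sgn_div_norm)

lemma linear_matrix_mult_both: "linear (\<lambda>X :: real^'m^'n. A ** X ** B)"
  by (rule linearI)
     (simp_all add: matrix_matrix_mult_def vec_eq_iff sum.distrib distrib_left distrib_right
       sum_distrib_left sum_distrib_right ac_simps)

section \<open>Affine invariance by rescaling of directions\<close>

lemma ennreal_divide_mult_left:
  assumes "0 < c" "0 \<le> x" "0 \<le> y"
  shows "ennreal (c * x) / ennreal (c * y) = ennreal x / ennreal y"
proof (cases "y = 0")
  \<comment> \<open>With a zero denominator both sides are 0 if \<open>x = 0\<close> and both are
    \<open>\<top>\<close> otherwise.\<close>
  case True
  then show ?thesis
    using assms by (cases "x = 0") (auto simp: ennreal_mult)
next
  case False
  then show ?thesis
    using assms by (simp add: divide_ennreal)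
qed

text \<open>Equivariance brings the factor \<open>a * b\<close> out of location and scale alike. It
  is positive, so it passes through the absolute values and cancels, even where the scale is
  0.\<close>

lemma ratio_scaleR:
  assumes "\<X> \<in> M \<rightarrow>\<^sub>M borel" "location_functional D \<mu>" "scale_functional D \<sigma>"
    and "proj_law M \<X> u v \<in> D" "0 < a" "0 < b"
  shows "ratio \<mu> \<sigma> M X \<X> (a *\<^sub>R u) (b *\<^sub>R v) = ratio \<mu> \<sigma> M X \<X> u v"
proof -
  let ?F = "proj_law M \<X> u v"
  have m: "\<mu> (proj_law M \<X> (a *\<^sub>R u) (b *\<^sub>R v)) = a * b * \<mu> ?F"
    using assms by (simp add: location_functional_def proj_law_scaleR)
  have s: "\<sigma> (proj_law M \<X> (a *\<^sub>R u) (b *\<^sub>R v)) = a * b * \<sigma> ?F" "0 \<le> \<sigma> ?F"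
    using assms by (auto simp: scale_functional_def proj_law_scaleR abs_mult)
  have d: "\<bar>bilin X (a *\<^sub>R u) (b *\<^sub>R v) - a * b * \<mu> ?F\<bar> = a * b * \<bar>bilin X u v - \<mu> ?F\<bar>"
    using assms
    by (simp add: bilin_scaleR_vectors right_diff_distrib[symmetric] abs_mult)
  show ?thesis
    unfolding ratio_def m s d using assms s(2) by (intro ennreal_divide_mult_left) auto
qed

text \<open>Membership is assumed for unit directions only. Writing a vector as its norm times its
  \<open>sgn\<close> makes the general law an affine image of a unit one, and \<open>D\<close> is
  closed under affine maps.\<close>

lemma proj_law_nonzero_in_class:
  assumes "\<X> \<in> M \<rightarrow>\<^sub>M borel" "distribution_class D"
    and "\<And>u v. norm u = 1 \<Longrightarrow> norm v = 1 \<Longrightarrow> proj_law M \<X> u v \<in> D"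
    and "u \<noteq> 0" "v \<noteq> 0"
  shows "proj_law M \<X> u v \<in> D"
proof -
  have "proj_law M \<X> (sgn u) (sgn v) \<in> D"
    using assms by (intro assms(3)) (auto simp: norm_sgn)
  then have "affine_law (proj_law M \<X> (sgn u) (sgn v)) (norm u * norm v) 0 \<in> D"
    using assms(2) by (auto simp: distribution_class_def)
  then show ?thesis
    using proj_law_scaleR[OF assms(1), of "norm u" "sgn u" "norm v" "sgn v"]
    by (simp add: norm_scaleR_sgn)
qed

text \<open>Unlike the unit spheres, the new index set is preserved by invertible matrices. No
  larger values appear, since the quotient at \<open>u\<close>, \<open>v\<close> equals the one at
  \<open>sgn u\<close>, \<open>sgn v\<close>.\<close>

lemma outlyingness_nonzero:
  assumes "\<X> \<in> M \<rightarrow>\<^sub>M borel" "location_functional D \<mu>" "scale_functional D \<sigma>"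
    and "\<And>u v. norm u = 1 \<Longrightarrow> norm v = 1 \<Longrightarrow> proj_law M \<X> u v \<in> D"
  shows "outlyingness \<mu> \<sigma> M X \<X> = (SUP (u, v) \<in> (-{0}) \<times> (-{0}). ratio \<mu> \<sigma> M X \<X> u v)"
proof (rule antisym)
  show "outlyingness \<mu> \<sigma> M X \<X> \<le> (SUP (u, v) \<in> (-{0}) \<times> (-{0}). ratio \<mu> \<sigma> M X \<X> u v)"
    unfolding outlyingness_ratio by (rule SUP_subset_mono) auto
  have "ratio \<mu> \<sigma> M X \<X> u v \<le> outlyingness \<mu> \<sigma> M X \<X>" if "u \<noteq> 0" "v \<noteq> 0" for u v
  proof -
    have n: "norm (sgn u) = 1" "norm (sgn v) = 1"
      using that by (auto simp: norm_sgn)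
    have "ratio \<mu> \<sigma> M X \<X> (norm u *\<^sub>R sgn u) (norm v *\<^sub>R sgn v) = ratio \<mu> \<sigma> M X \<X> (sgn u) (sgn v)"
      using that n by (intro ratio_scaleR[OF assms(1-3)] assms(4)) auto
    then show ?thesis
      using ratio_le_outlyingness[OF n, of \<mu> \<sigma> M X \<X>] by (simp add: norm_scaleR_sgn)
  qed
  then show "(SUP (u, v) \<in> (-{0}) \<times> (-{0}). ratio \<mu> \<sigma> M X \<X> u v) \<le> outlyingness \<mu> \<sigma> M X \<X>"
    by (intro SUP_least) auto
qed

lemma image_nonzero_invertible:
  fixes A :: "real^'n^'n"
  assumes "invertible A"
  shows "(*v) A ` (-{0}) = -{0}"
proof -
  have "bij ((*v) A)"
    using assms by (simp add: invertible_eq_bij)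
  then show ?thesis
    by (simp add: bij_image_Compl_eq)
qed

lemma outlyingness_mult:
  fixes A :: "real^'n1^'n1" and B :: "real^'n2^'n2" and \<X> :: "'a \<Rightarrow> real^'n2^'n1"
  assumes meas: "\<X> \<in> M \<rightarrow>\<^sub>M borel"
    and D: "distribution_class D" "location_functional D \<mu>" "scale_functional D \<sigma>"
    and law: "\<And>u v. norm u = 1 \<Longrightarrow> norm v = 1 \<Longrightarrow> proj_law M \<X> u v \<in> D"
    and inv: "invertible A" "invertible B"
  shows "outlyingness \<mu> \<sigma> M (A ** X ** B) (\<lambda>\<omega>. A ** \<X> \<omega> ** B) = outlyingness \<mu> \<sigma> M X \<X>"
proof -
  let ?N1 = "-{0} :: (real^'n1) set" and ?N2 = "-{0} :: (real^'n2) set"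
  have tA: "invertible (transpose A)"
    using inv by (simp add: transpose_invertible)
  note imA = image_nonzero_invertible[OF tA] and imB = image_nonzero_invertible[OF inv(2)]
  have "(\<lambda>X. A ** X ** B) \<in> borel \<rightarrow>\<^sub>M borel"
    using linear_matrix_mult_both
    by (intro borel_measurable_continuous_onI linear_continuous_on)
       (simp add: linear_conv_bounded_linear)
  then have meas': "(\<lambda>\<omega>. A ** \<X> \<omega> ** B) \<in> M \<rightarrow>\<^sub>M borel"
    using meas by (rule measurable_compose[rotated])
  \<comment> \<open>The passage to nonzero vectors is also applied to the transformed random
    element. Its unit projections are projections of \<open>\<X>\<close> along nonzero vectors, so
    their laws lie in \<open>D\<close>.\<close>
  have law': "proj_law M (\<lambda>\<omega>. A ** \<X> \<omega> ** B) u v \<in> D" if "norm u = 1" "norm v = 1" for u v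
  proof -
    have "u \<in> ?N1" "v \<in> ?N2"
      using that by auto
    then have "transpose A *v u \<noteq> 0" "B *v v \<noteq> 0"
      using imA imB by blast+
    then show ?thesis
      unfolding proj_law_mult by (intro proj_law_nonzero_in_class[OF meas D(1) law])
  qed
  \<comment> \<open>The matrices move from the tensors onto the directions. What remains is a
    reindexing of the supremum along a map of the nonzero pairs onto themselves.\<close>
  have "outlyingness \<mu> \<sigma> M (A ** X ** B) (\<lambda>\<omega>. A ** \<X> \<omega> ** B) =
      (SUP p \<in> ?N1 \<times> ?N2. case map_prod ((*v) (transpose A)) ((*v) B) p of (u, v) \<Rightarrow> ratio \<mu> \<sigma> M X \<X> u v)"
    using outlyingness_nonzero[OF meas' D(2,3), of "A ** X ** B"] law'
    by (simp add: ratio_mult case_prod_beta)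
  also have "\<dots> = (SUP (u, v) \<in> map_prod ((*v) (transpose A)) ((*v) B) ` (?N1 \<times> ?N2). ratio \<mu> \<sigma> M X \<X> u v)"
    by (simp add: image_image)
  also have "map_prod ((*v) (transpose A)) ((*v) B) ` (?N1 \<times> ?N2) = ?N1 \<times> ?N2"
    unfolding map_prod_surj_on[OF imA imB] ..
  finally show ?thesis
    using outlyingness_nonzero[OF meas D(2,3), of X] law by simp
qed

section \<open>Convex depth regions and monotonicity towards a deepest point\<close>

lemma outlyingness_quasiconvex:
  assumes "0 \<le> a" "0 \<le> b" "a + b = 1"
  shows "outlyingness \<mu> \<sigma> M (a *\<^sub>R X + b *\<^sub>R Y) \<X>
         \<le> max (outlyingness \<mu> \<sigma> M X \<X>) (outlyingness \<mu> \<sigma> M Y \<X>)"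
proof (rule outlyingness_leI)
  fix u :: "real^'c" and v :: "real^'b"
  assume uv: "norm u = 1" "norm v = 1"
  define m where "m = \<mu> (proj_law M \<X> u v)"
  let ?x = "bilin X u v - m" and ?y = "bilin Y u v - m"
  \<comment> \<open>As \<open>a + b = 1\<close>, the location splits as
    \<open>a * m + b * m\<close>; it is the same for both tensors because it depends on the law of
    \<open>\<X>\<close> alone.\<close>
  have "a * bilin X u v + b * bilin Y u v - m = a * ?x + b * ?y"
    using arg_cong[OF assms(3), of "\<lambda>c. c * m"] by (simp add: algebra_simps)
  also have "\<bar>\<dots>\<bar> \<le> a * \<bar>?x\<bar> + b * \<bar>?y\<bar>"
    using assms by (intro order_trans[OF abs_triangle_ineq]) (simp add: abs_mult)
  also have "\<dots> \<le> max \<bar>?x\<bar> \<bar>?y\<bar>"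
    using assms by (intro convex_bound_le) auto
  \<comment> \<open>The bound by a maximum is stated as a disjunction, so that each case can be
    divided by the common scale in \<open>ennreal\<close>.\<close>
  finally have "\<bar>bilin (a *\<^sub>R X + b *\<^sub>R Y) u v - m\<bar> \<le> \<bar>?x\<bar> \<or>
      \<bar>bilin (a *\<^sub>R X + b *\<^sub>R Y) u v - m\<bar> \<le> \<bar>?y\<bar>"
    by (auto simp: bilin_add bilin_scaleR)
  then have "ratio \<mu> \<sigma> M (a *\<^sub>R X + b *\<^sub>R Y) \<X> u v \<le> ratio \<mu> \<sigma> M X \<X> u v \<or>
      ratio \<mu> \<sigma> M (a *\<^sub>R X + b *\<^sub>R Y) \<X> u v \<le> ratio \<mu> \<sigma> M Y \<X> u v"
    unfolding ratio_def m_def by (auto intro!: divide_right_mono_ennreal ennreal_leI)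
  then show "ratio \<mu> \<sigma> M (a *\<^sub>R X + b *\<^sub>R Y) \<X> u v
      \<le> max (outlyingness \<mu> \<sigma> M X \<X>) (outlyingness \<mu> \<sigma> M Y \<X>)"
    using ratio_le_outlyingness[OF uv] by (meson max.coboundedI1 max.coboundedI2 order_trans)
qed

lemma TPD_antimono:
  assumes "outlyingness \<mu> \<sigma> M X \<X> \<le> outlyingness \<mu> \<sigma> M Y \<X>"
  shows "TPD \<mu> \<sigma> M Y \<X> \<le> TPD \<mu> \<sigma> M X \<X>"
  unfolding TPD_def
proof (rule enn2real_mono)
  show "1 / (1 + outlyingness \<mu> \<sigma> M Y \<X>) \<le> 1 / (1 + outlyingness \<mu> \<sigma> M X \<X>)"
    unfolding divide_ennreal_def
    using assms by (intro mult_left_mono) (auto intro!: ennreal_inverse_antimono add_left_mono)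
  \<comment> \<open>\<open>enn2real\<close> sends \<open>\<top>\<close> to 0 and is monotone only
    below a finite value; here the denominator is at least 1.\<close>
  show "1 / (1 + outlyingness \<mu> \<sigma> M X \<X>) < \<top>"
    by (simp add: ennreal_divide_eq_top_iff less_top[symmetric])
qed

lemma convex_depth_TPD: "convex_depth (\<lambda>X. TPD \<mu> \<sigma> M X \<X>)"
  unfolding convex_depth_def convex_def
proof (intro allI ballI impI, simp only: mem_Collect_eq)
  fix \<alpha> a b :: real and X Y
  assume depth: "\<alpha> \<le> TPD \<mu> \<sigma> M X \<X>" "\<alpha> \<le> TPD \<mu> \<sigma> M Y \<X>"
    and ab: "0 \<le> a" "0 \<le> b" "a + b = 1"
  let ?Z = "a *\<^sub>R X + b *\<^sub>R Y"
  have "outlyingness \<mu> \<sigma> M ?Z \<X> \<le> outlyingness \<mu> \<sigma> M X \<X> \<or>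
      outlyingness \<mu> \<sigma> M ?Z \<X> \<le> outlyingness \<mu> \<sigma> M Y \<X>"
    using outlyingness_quasiconvex[OF ab] by (simp add: le_max_iff_disj)
  then show "\<alpha> \<le> TPD \<mu> \<sigma> M ?Z \<X>"
    using depth by (auto dest!: TPD_antimono)
qed

text \<open>The upper level set at height \<open>d x\<close> contains both \<open>x\<close> and
  \<open>c\<close>, hence by convexity the whole segment between them.\<close>

lemma convex_depth_mono_to_deepest:
  assumes "convex_depth d" "deepest_point d c" "0 \<le> t" "t \<le> 1"
  shows "d x \<le> d (t *\<^sub>R x + (1 - t) *\<^sub>R c)"
proof -
  have "convex {y. d x \<le> d y}" "d x \<le> d c"
    using assms by (auto simp: convex_depth_def deepest_point_def)
  then show ?thesis
    using assms convexD[of "{y. d x \<le> d y}" x c t "1 - t"] by auto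
qed

section \<open>Reflection in the center and outlyingness of the center\<close>

lemma mu_symmetric_outlyingness_reflect:
  assumes "mu_symmetric \<mu> M \<X> \<theta>"
  shows "outlyingness \<mu> \<sigma> M (\<theta> + X) \<X> = outlyingness \<mu> \<sigma> M (\<theta> - X) \<X>"
  unfolding outlyingness_def
  \<comment> \<open>The location cancels against \<open>bilin \<theta> u v\<close>, which leaves the
    absolute values of \<open>bilin X u v\<close> and of its negative.\<close>
  using assms by (intro SUP_cong) (auto simp: mu_symmetric_def bilin_add bilin_diff)

lemma mu_symmetric_outlyingness_center:
  assumes "mu_symmetric \<mu> M \<X> \<theta>"
  shows "outlyingness \<mu> \<sigma> M \<theta> \<X> = 0"
proof -
  \<comment> \<open>All numerators vanish at the center, and \<open>0 / 0 = 0\<close> covers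
    directions with zero scale.\<close>
  have "outlyingness \<mu> \<sigma> M \<theta> \<X> \<le> 0"
    using assms by (intro outlyingness_leI) (auto simp: mu_symmetric_def ratio_def)
  then show ?thesis
    by simp
qed

section \<open>Vanishing at infinity\<close>

lemma ennreal_divide_leD:
  assumes "ennreal x / ennreal s \<le> ennreal r" "0 \<le> s" "0 \<le> r"
  shows "x \<le> r * (s + 1)"
proof (cases "s = 0")
  case True
  \<comment> \<open>A zero scale cannot hide a large numerator: a positive \<open>x\<close> would
    make the quotient \<open>\<top>\<close>, above the finite bound.\<close>
  then have "ennreal x = 0"
    using assms(1) by (cases "ennreal x = 0") (auto simp: ennreal_divide_eq_top_iff top_unique)
  then show ?thesis
    using assms by (simp add: ennreal_eq_0_iff) (meson add_nonneg_nonneg mult_nonneg_nonneg order_trans zero_le_one)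
next
  case False
  show ?thesis
  proof (cases "0 \<le> x")
    case True
    then have "x / s \<le> r"
      using False assms by (simp add: divide_ennreal)
    then show ?thesis
      using False assms by (simp add: field_simps)
  next
    \<comment> \<open>\<open>ennreal\<close> truncates a negative \<open>x\<close> to 0, so here the
      nonnegativity of the bound decides.\<close>
    case False
    moreover have "0 \<le> r * (s + 1)"
      using assms by simp
    ultimately show ?thesis
      by linarith
  qed
qed

text \<open>The Frobenius norm is the Euclidean norm of the row norms; the Euclidean norm is at most
  the sum of absolute values, used once across rows and once within each row.\<close>

lemma norm_le_sum_entries:
  fixes X :: "real^'n2^'n1"
  shows "norm X \<le> (\<Sum>i\<in>UNIV. \<Sum>j\<in>UNIV. \<bar>X $ i $ j\<bar>)"
proof -
  have "norm X \<le> (\<Sum>i\<in>UNIV. norm (X $ i))"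
    unfolding norm_vec_def by (rule L2_set_le_sum) simp
  also have "\<dots> \<le> (\<Sum>i\<in>UNIV. \<Sum>j\<in>UNIV. \<bar>X $ i $ j\<bar>)"
    by (intro sum_mono norm_le_l1_cart)
  finally show ?thesis .
qed

text \<open>A pair of axis vectors reads off one entry of \<open>X\<close>. Bounded outlyingness
  therefore confines each entry to an interval around its location \<open>m i j\<close>, with a
  radius that does not depend on \<open>X\<close>.\<close>

lemma bounded_outlyingness_le:
  assumes "\<And>u v. norm u = 1 \<Longrightarrow> norm v = 1 \<Longrightarrow> 0 \<le> \<sigma> (proj_law M \<X> u v)" and "0 \<le> r"
  shows "bounded {X. outlyingness \<mu> \<sigma> M X \<X> \<le> ennreal r}"
proof -
  define m where "m i j = \<mu> (proj_law M \<X> (axis i 1) (axis j 1))" for i j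
  define s where "s i j = \<sigma> (proj_law M \<X> (axis i 1) (axis j 1))" for i j
  have "norm X \<le> (\<Sum>i\<in>UNIV. \<Sum>j\<in>UNIV. r * (s i j + 1) + \<bar>m i j\<bar>)"
    if "outlyingness \<mu> \<sigma> M X \<X> \<le> ennreal r" for X
  proof -
    have "\<bar>X $ i $ j\<bar> \<le> r * (s i j + 1) + \<bar>m i j\<bar>" for i j
    proof -
      have "ratio \<mu> \<sigma> M X \<X> (axis i 1) (axis j 1) \<le> ennreal r"
        using that by (intro order_trans[OF ratio_le_outlyingness]) auto
      then have "\<bar>X $ i $ j - m i j\<bar> \<le> r * (s i j + 1)"
        using assms by (intro ennreal_divide_leD) (auto simp: ratio_def bilin_axis m_def s_def)
      then show ?thesis
        by linarith
    qed
    then show ?thesis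
      by (intro order_trans[OF norm_le_sum_entries] sum_mono)
  qed
  then show ?thesis
    by (auto simp: bounded_iff)
qed

lemma TPD_le:
  assumes "ennreal r \<le> outlyingness \<mu> \<sigma> M X \<X>" "0 \<le> r"
  shows "TPD \<mu> \<sigma> M X \<X> \<le> 1 / (1 + r)"
proof -
  have "1 / (1 + outlyingness \<mu> \<sigma> M X \<X>) \<le> 1 / (1 + ennreal r)"
    unfolding divide_ennreal_def
    using assms by (intro mult_left_mono) (auto intro!: ennreal_inverse_antimono add_left_mono)
  also have "\<dots> = ennreal (1 / (1 + r))"
    using assms by (simp flip: ennreal_1 ennreal_plus add: divide_ennreal)
  finally show ?thesis
    unfolding TPD_def using assms by (intro enn2real_leI) auto
qed

lemma TPD_vanishes_at_infinity:
  assumes "\<And>u v. norm u = 1 \<Longrightarrow> norm v = 1 \<Longrightarrow> 0 \<le> \<sigma> (proj_law M \<X> u v)"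
  shows "((\<lambda>X. TPD \<mu> \<sigma> M X \<X>) \<longlongrightarrow> 0) at_infinity"
proof (rule tendstoI)
  fix e :: real
  assume e: "0 < e"
  \<comment> \<open>Outlyingness at least \<open>1 / e\<close> gives depth at most
    \<open>1 / (1 + 1 / e) = e / (e + 1)\<close>, strictly below \<open>e\<close>.\<close>
  let ?r = "1 / e"
  obtain b where b: "\<And>X. outlyingness \<mu> \<sigma> M X \<X> \<le> ennreal ?r \<Longrightarrow> norm X \<le> b"
    using bounded_outlyingness_le[of \<sigma> M \<X> ?r \<mu>] assms e by (auto simp: bounded_iff)
  \<comment> \<open>Contrapositive of \<open>b\<close>: a norm of at least \<open>b + 1\<close>
    exceeds \<open>b\<close>, so the outlyingness exceeds \<open>1 / e\<close>.\<close>
  have "dist (TPD \<mu> \<sigma> M X \<X>) 0 < e" if "b + 1 \<le> norm X" for X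
  proof -
    have "ennreal ?r \<le> outlyingness \<mu> \<sigma> M X \<X>"
      using b[of X] that by (cases "outlyingness \<mu> \<sigma> M X \<X> \<le> ennreal ?r") auto
    then have "TPD \<mu> \<sigma> M X \<X> \<le> 1 / (1 + ?r)"
      using e by (intro TPD_le) auto
    also have "\<dots> < e"
      using e by (simp add: field_simps)
    finally show ?thesis
      by (simp add: TPD_def)
  qed
  then show "\<forall>\<^sub>F X in at_infinity. dist (TPD \<mu> \<sigma> M X \<X>) 0 < e"
    by (auto simp: eventually_at_infinity)
qed

theorem theorem4p1:
  fixes M :: "'a measure"
    and \<X> :: "'a \<Rightarrow> real^'n2^'n1"
    and \<mu> \<sigma> :: "real measure \<Rightarrow> real"
    and D :: "real measure set"
  assumes "prob_space M"
    and "\<X> \<in> M \<rightarrow>\<^sub>M borel"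
    and "distribution_class D"
    and "location_functional D \<mu>"
    and "scale_functional D \<sigma>"
    and "\<And>u v. norm u = 1 \<Longrightarrow> norm v = 1 \<Longrightarrow> proj_law M \<X> u v \<in> D"
  shows
    "convex_depth (\<lambda>X. TPD \<mu> \<sigma> M X \<X>)
     \<and> (\<forall>\<theta>. mu_symmetric \<mu> M \<X> \<theta> \<longrightarrow>
          (\<forall>X. TPD \<mu> \<sigma> M (\<theta> + X) \<X> = TPD \<mu> \<sigma> M (\<theta> - X) \<X>))
     \<and> (\<forall>(A :: real^'n1^'n1) (B :: real^'n2^'n2) X. invertible A \<longrightarrow> invertible B \<longrightarrow>
          TPD \<mu> \<sigma> M (A ** X ** B) (\<lambda>\<omega>. A ** \<X> \<omega> ** B) = TPD \<mu> \<sigma> M X \<X>)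
     \<and> (\<forall>Xc X1 X2 t. deepest_point (\<lambda>X. TPD \<mu> \<sigma> M X \<X>) Xc \<longrightarrow> 0 \<le> t \<longrightarrow> t \<le> 1 \<longrightarrow>
          X1 = t *\<^sub>R X2 + (1 - t) *\<^sub>R Xc \<longrightarrow> TPD \<mu> \<sigma> M X2 \<X> \<le> TPD \<mu> \<sigma> M X1 \<X>)
     \<and> ((\<lambda>X. TPD \<mu> \<sigma> M X \<X>) \<longlongrightarrow> 0) at_infinity
     \<and> (\<forall>\<theta>. mu_symmetric \<mu> M \<X> \<theta> \<longrightarrow> deepest_point (\<lambda>X. TPD \<mu> \<sigma> M X \<X>) \<theta>)"
proof (intro conjI allI impI)
  have scale_nonneg: "0 \<le> \<sigma> (proj_law M \<X> u v)" if "norm u = 1" "norm v = 1" for u v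
    using assms(5) assms(6)[OF that] by (auto simp: scale_functional_def)
  show "convex_depth (\<lambda>X. TPD \<mu> \<sigma> M X \<X>)"
    by (rule convex_depth_TPD)
  show "TPD \<mu> \<sigma> M (\<theta> + X) \<X> = TPD \<mu> \<sigma> M (\<theta> - X) \<X>" if "mu_symmetric \<mu> M \<X> \<theta>" for \<theta> X
    unfolding TPD_def mu_symmetric_outlyingness_reflect[OF that] ..
  show "TPD \<mu> \<sigma> M (A ** X ** B) (\<lambda>\<omega>. A ** \<X> \<omega> ** B) = TPD \<mu> \<sigma> M X \<X>"
    if "invertible A" "invertible B" for A :: "real^'n1^'n1" and B :: "real^'n2^'n2" and X
    unfolding TPD_def by (subst outlyingness_mult[OF assms(2-5) _ that]) (use assms(6) in auto)
  show "TPD \<mu> \<sigma> M X2 \<X> \<le> TPD \<mu> \<sigma> M X1 \<X>"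
    if "deepest_point (\<lambda>X. TPD \<mu> \<sigma> M X \<X>) Xc" "0 \<le> t" "t \<le> 1" "X1 = t *\<^sub>R X2 + (1 - t) *\<^sub>R Xc"
    for Xc X1 X2 t
    unfolding that(4) by (rule convex_depth_mono_to_deepest[OF convex_depth_TPD that(1-3)])
  show "((\<lambda>X. TPD \<mu> \<sigma> M X \<X>) \<longlongrightarrow> 0) at_infinity"
    using scale_nonneg by (rule TPD_vanishes_at_infinity)
  show "deepest_point (\<lambda>X. TPD \<mu> \<sigma> M X \<X>) \<theta>" if "mu_symmetric \<mu> M \<X> \<theta>" for \<theta>
    unfolding deepest_point_def
    \<comment> \<open>The outlyingness at \<open>\<theta>\<close> is 0, the least element of
      \<open>ennreal\<close>.\<close>
    by (intro allI TPD_antimono) (simp add: mu_symmetric_outlyingness_center[OF that])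
qed

end
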